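(* Let $(G,\alpha)$ be an edge-labeled graph (simple or multigraph) over a commutative ring $R$ with unity. If $(G,\alpha)$ does not satisfy the Universal Difference Property, then no subdivision of $(G,\alpha)$ satisfies the Universal Difference Property.
   Context: An edge-labeling assigns to each edge (parallel edges allowed) an ideal of $R$. A spline on $(G,\alpha)$ is a function $\rho:V(G)\to R$ such that for every edge $e$ with endpoints $u,v$, $\rho(u)-\rho(v)\in\alpha(e)$. A path from $u$ to $v$ is a sequence of edges joining distinct consecutive vertices with no repeated vertices; $\alpha(P)$ is the sum of the ideals labeling the edges of $P$. $(G,\alpha)$ satisfies the Universal Difference Property (UDP) if for every pair of vertices $u,w$ and every $x$ in the intersection of $\alpha(P)$ over all paths $P$ from $u$ to $w$, there exists a spline $\rho$ with $\rho(u)-\rho(w)=x$. A subdivision of $G$ is obtained by successively replacing an edge $uv$ by a path $u,w,v$ through a new vertex $w$. A subdivision $(G',\alpha')$ of $(G,\alpha)$ has $G'$ a subdivision of $G$, with unsubdivided edges keeping their labels and every edge created by subdividing an edge $e$ labeled $\alpha(e)$. *)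

theory Defs
  imports "HOL-Algebra.Algebra"
begin

text \<open>
  Undirected multigraphs: edges are abstract names, so parallel edges are allowed, and a simple
  graph is the case where \<open>ends\<close> is injective on the edges and there are no loops.
  An edge with \<open>ends e = {u}\<close> is a loop; it lies on no path and imposes no spline condition.
  Vertex and edge sets may be infinite.
\<close>

record ('v, 'e) mgraph =
  verts :: "'v set"
  edges :: "'e set"
  ends :: "'e \<Rightarrow> 'v set"

definition multigraph :: "('v, 'e) mgraph \<Rightarrow> bool" where
  "multigraph G \<longleftrightarrow> (\<forall>e\<in>edges G. \<exists>u\<in>verts G. \<exists>v\<in>verts G. ends G e = {u, v})"

definition edge_labeling ::
  "('r, 'm) ring_scheme \<Rightarrow> ('v, 'e) mgraph \<Rightarrow> ('e \<Rightarrow> 'r set) \<Rightarrow> bool" where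
  "edge_labeling R G \<alpha> \<longleftrightarrow> (\<forall>e\<in>edges G. ideal (\<alpha> e) R)"

definition spline ::
  "('r, 'm) ring_scheme \<Rightarrow> ('v, 'e) mgraph \<Rightarrow> ('e \<Rightarrow> 'r set) \<Rightarrow> ('v \<Rightarrow> 'r) \<Rightarrow> bool" where
  "spline R G \<alpha> \<rho> \<longleftrightarrow>
     \<rho> \<in> verts G \<rightarrow> carrier R \<and>
     (\<forall>e\<in>edges G. \<forall>u v. ends G e = {u, v} \<longrightarrow> \<rho> u \<ominus>\<^bsub>R\<^esub> \<rho> v \<in> \<alpha> e)"

text \<open>
  Paths are given by their edge sequences; \<open>vs\<close> is the list of vertices visited.
  The empty sequence is the only path from a vertex to itself.
\<close>

definition paths :: "('v, 'e) mgraph \<Rightarrow> 'v \<Rightarrow> 'v \<Rightarrow> 'e list set" where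
  "paths G u w =
     {es. \<exists>vs. length vs = Suc (length es) \<and> hd vs = u \<and> last vs = w \<and>
               set vs \<subseteq> verts G \<and> distinct vs \<and>
               (\<forall>i<length es. es ! i \<in> edges G \<and> ends G (es ! i) = {vs ! i, vs ! Suc i})}"

definition path_ideal :: "('r, 'm) ring_scheme \<Rightarrow> ('e \<Rightarrow> 'r set) \<Rightarrow> 'e list \<Rightarrow> 'r set" where
  "path_ideal R \<alpha> es = foldr (\<lambda>e I. \<alpha> e <+>\<^bsub>R\<^esub> I) es {\<zero>\<^bsub>R\<^esub>}"

text \<open>
  The intersection is taken inside \<open>carrier R\<close>, hence is all of \<open>R\<close> if no path
  joins \<open>u\<close> and \<open>w\<close>.
\<close>

definition UDP :: "('r, 'm) ring_scheme \<Rightarrow> ('v, 'e) mgraph \<Rightarrow> ('e \<Rightarrow> 'r set) \<Rightarrow> bool" where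
  "UDP R G \<alpha> \<longleftrightarrow>
     (\<forall>u\<in>verts G. \<forall>w\<in>verts G. \<forall>x \<in> carrier R \<inter> (\<Inter>P\<in>paths G u w. path_ideal R \<alpha> P).
        \<exists>\<rho>. spline R G \<alpha> \<rho> \<and> \<rho> u \<ominus>\<^bsub>R\<^esub> \<rho> w = x)"

text \<open>
  The edge \<open>e\<close> is replaced by a path with edges \<open>e1, e2\<close> through a new vertex \<open>w\<close>.
  One of the new edges may reuse the name \<open>e\<close>.
\<close>

definition subdivide_edge ::
  "('v, 'e) mgraph \<Rightarrow> ('e \<Rightarrow> 'r set) \<Rightarrow> ('v, 'e) mgraph \<Rightarrow> ('e \<Rightarrow> 'r set) \<Rightarrow> bool" where
  "subdivide_edge G \<alpha> G' \<alpha>' \<longleftrightarrow>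
     (\<exists>e u v w e1 e2.
        e \<in> edges G \<and> ends G e = {u, v} \<and> w \<notin> verts G \<and>
        e1 \<noteq> e2 \<and> e1 \<notin> edges G - {e} \<and> e2 \<notin> edges G - {e} \<and>
        verts G' = insert w (verts G) \<and>
        edges G' = (edges G - {e}) \<union> {e1, e2} \<and>
        (\<forall>f \<in> edges G - {e}. ends G' f = ends G f \<and> \<alpha>' f = \<alpha> f) \<and>
        ends G' e1 = {u, w} \<and> ends G' e2 = {w, v} \<and>
        \<alpha>' e1 = \<alpha> e \<and> \<alpha>' e2 = \<alpha> e)"

inductive subdivision ::
  "('v, 'e) mgraph \<Rightarrow> ('e \<Rightarrow> 'r set) \<Rightarrow> ('v, 'e) mgraph \<Rightarrow> ('e \<Rightarrow> 'r set) \<Rightarrow> bool"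
  for G :: "('v, 'e) mgraph" and \<alpha> :: "'e \<Rightarrow> 'r set" where
  refl: "subdivision G \<alpha> G \<alpha>"
| step: "subdivision G \<alpha> H \<beta> \<Longrightarrow> subdivide_edge H \<beta> H' \<beta>' \<Longrightarrow> subdivision G \<alpha> H' \<beta>'"

end

theory Submission
  imports Defs
begin

text \<open>
  It suffices to treat one subdivision step, replacing \<open>e\<close> by \<open>e1, e2\<close> through the new vertex \<open>w\<close>.
  A path of the subdivided graph between old vertices either avoids \<open>w\<close>, or runs through both
  \<open>e1\<close> and \<open>e2\<close>, consecutively; contracting these two edges to \<open>e\<close> gives a path of the old graph
  whose ideal is contained in that of the original path. Hence the intersection over the old
  paths lies in the intersection over the new ones. Conversely, a spline of the subdivided graph
  restricts to a spline of the old graph, since the difference along \<open>e\<close> is the sum of the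
  differences along \<open>e1\<close> and \<open>e2\<close>.
\<close>

text \<open>Recursive form of \<open>paths\<close>, suited to surgery at the front of a path. The
  index set records the visited vertices, so distinctness becomes one non-membership when an edge is
  prepended. The end \<open>b\<close> stays fixed while the start varies.\<close>

inductive path_visiting :: "('v, 'e) mgraph \<Rightarrow> 'v \<Rightarrow> 'v \<Rightarrow> 'v set \<Rightarrow> 'e list \<Rightarrow> bool"
  for G :: "('v, 'e) mgraph" and b :: 'v where
  Nil: "b \<in> verts G \<Longrightarrow> path_visiting G b b {b} []"
| Cons: "path_visiting G b c S es \<Longrightarrow> f \<in> edges G \<Longrightarrow> ends G f = {a, c} \<Longrightarrow> a \<in> verts G
    \<Longrightarrow> a \<notin> S \<Longrightarrow> path_visiting G b a (insert a S) (f # es)"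

lemma path_visiting_start: "path_visiting G b a S es \<Longrightarrow> a \<in> S"
  by (induction rule: path_visiting.induct) auto

lemma path_visiting_verts: "path_visiting G b a S es \<Longrightarrow> S \<subseteq> verts G"
  by (induction rule: path_visiting.induct) auto

lemma path_visiting_if_vertex_list:
  assumes "length vs = Suc (length es)" "set vs \<subseteq> verts G" "distinct vs"
    and "\<forall>i<length es. es ! i \<in> edges G \<and> ends G (es ! i) = {vs ! i, vs ! Suc i}"
  shows "path_visiting G (last vs) (hd vs) (set vs) es"
  using assms
proof (induction es arbitrary: vs)
  case Nil
  then obtain v where "vs = [v]" by (auto simp: length_Suc_conv)
  then show ?case using Nil by (auto intro: path_visiting.Nil)
next
  case (Cons f es)
  then obtain a c ws where vs: "vs = a # c # ws" by (auto simp: length_Suc_conv)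
  have edge: "f \<in> edges G" "ends G f = {a, c}" using Cons.prems(4) vs by force+
  have tail: "\<forall>i<length es. es ! i \<in> edges G \<and> ends G (es ! i) = {(c # ws) ! i, (c # ws) ! Suc i}"
  proof (intro allI impI)
    fix i assume "i < length es"
    then show "es ! i \<in> edges G \<and> ends G (es ! i) = {(c # ws) ! i, (c # ws) ! Suc i}"
      using Cons.prems(4)[rule_format, of "Suc i"] vs by simp
  qed
  have "path_visiting G (last (c # ws)) (hd (c # ws)) (set (c # ws)) es"
    using Cons.prems vs tail by (intro Cons.IH) auto
  from path_visiting.Cons[of G _ _ _ _ f a, OF this] edge Cons.prems vs
  show ?case by simp
qed

lemma vertex_list_if_path_visiting:
  assumes "path_visiting G b a S es"
  shows "\<exists>vs. length vs = Suc (length es) \<and> hd vs = a \<and> last vs = b \<and> set vs = S \<and> distinct vs \<and>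
    (\<forall>i<length es. es ! i \<in> edges G \<and> ends G (es ! i) = {vs ! i, vs ! Suc i})"
  using assms
proof induction
  case Nil
  show ?case by (rule exI[of _ "[b]"]) simp
next
  case (Cons c S es f a)
  then obtain vs where vs: "length vs = Suc (length es)" "hd vs = c" "last vs = b" "set vs = S"
    "distinct vs" "\<forall>i<length es. es ! i \<in> edges G \<and> ends G (es ! i) = {vs ! i, vs ! Suc i}"
    by blast
  \<comment> \<open>The new edge \<open>f\<close> joins positions 0 and 1 of \<open>a # vs\<close>,
    so the head of \<open>vs\<close> is needed in indexed form.\<close>
  have "vs ! 0 = c" using vs by (metis hd_conv_nth length_0_conv nat.distinct(1))
  then have "\<forall>i<length (f # es). (f # es) ! i \<in> edges G \<and>
      ends G ((f # es) ! i) = {(a # vs) ! i, (a # vs) ! Suc i}"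
    using vs Cons.hyps by (auto simp: less_Suc_eq_0_disj)
  then show ?case using vs Cons.hyps by (intro exI[of _ "a # vs"]) auto
qed

lemma paths_iff_path_visiting: "es \<in> paths G a b \<longleftrightarrow> (\<exists>S. path_visiting G b a S es)"
proof
  assume "es \<in> paths G a b"
  then show "\<exists>S. path_visiting G b a S es"
    unfolding paths_def using path_visiting_if_vertex_list by blast
next
  assume "\<exists>S. path_visiting G b a S es"
  then obtain S where "path_visiting G b a S es" ..
  with vertex_list_if_path_visiting path_visiting_verts
  show "es \<in> paths G a b" unfolding paths_def by fastforce
qed

lemma (in ring) set_add_mono:
  "I \<subseteq> I' \<Longrightarrow> J \<subseteq> J' \<Longrightarrow> I <+>\<^bsub>R\<^esub> J \<subseteq> I' <+>\<^bsub>R\<^esub> J'"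
  unfolding set_add_def' by blast

lemma (in ring) subset_set_add_right:
  assumes "\<zero> \<in> I" "J \<subseteq> carrier R"
  shows "J \<subseteq> I <+>\<^bsub>R\<^esub> J"
  unfolding set_add_def' using assms by force

lemma (in ring) path_ideal_carrier:
  assumes "\<And>e. e \<in> set es \<Longrightarrow> \<alpha> e \<subseteq> carrier R"
  shows "path_ideal R \<alpha> es \<subseteq> carrier R"
  using assms by (induction es) (auto simp: path_ideal_def set_add_def')

lemma path_visiting_edges: "path_visiting G b a S es \<Longrightarrow> set es \<subseteq> edges G"
  by (induction rule: path_visiting.induct) auto

lemma multigraph_ends_subset: "multigraph G \<Longrightarrow> e \<in> edges G \<Longrightarrow> ends G e \<subseteq> verts G"
  unfolding multigraph_def by fastforce

text \<open>One subdivision step with all its witnesses fixed. A loop, \<open>u = v\<close>, is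
  allowed, and \<open>e1\<close> or \<open>e2\<close> may be the name \<open>e\<close>
  again.\<close>

locale edge_subdivision = cring R for R (structure) +
  fixes G G' :: "('v, 'e) mgraph" and \<alpha> \<alpha>' :: "'e \<Rightarrow> 'a set"
    and e e1 e2 :: 'e and u v w :: 'v
  assumes graph: "multigraph G"
    and labeling: "edge_labeling R G \<alpha>"
    and e: "e \<in> edges G" "ends G e = {u, v}"
    and w: "w \<notin> verts G"
    and verts': "verts G' = insert w (verts G)"
    and edges': "edges G' = (edges G - {e}) \<union> {e1, e2}"
    and old: "\<And>f. f \<in> edges G - {e} \<Longrightarrow> ends G' f = ends G f \<and> \<alpha>' f = \<alpha> f"
    and ends': "ends G' e1 = {u, w}" "ends G' e2 = {w, v}"
    and labels': "\<alpha>' e1 = \<alpha> e" "\<alpha>' e2 = \<alpha> e"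
begin

lemma uv: "u \<in> verts G" "v \<in> verts G"
  using multigraph_ends_subset[OF graph e(1)] e(2) by auto

lemma ideal_label: "f \<in> edges G \<Longrightarrow> ideal (\<alpha> f) R"
  using labeling unfolding edge_labeling_def by blast

lemma multigraph': "multigraph G'"
  unfolding multigraph_def
proof
  fix f assume f: "f \<in> edges G'"
  show "\<exists>a\<in>verts G'. \<exists>b\<in>verts G'. ends G' f = {a, b}"
  proof (cases "f = e1 \<or> f = e2")
    case True
    then show ?thesis using ends' uv verts' by auto
  next
    case False
    then have "f \<in> edges G" "ends G' f = ends G f" using f edges' old by auto
    moreover from this obtain a b where "a \<in> verts G" "b \<in> verts G" "ends G f = {a, b}"
      using graph unfolding multigraph_def by blast
    ultimately show ?thesis using verts' by (metis insertCI)
  qed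
qed

lemma edge_labeling': "edge_labeling R G' \<alpha>'"
  unfolding edge_labeling_def edges' using old labels' e ideal_label by auto

lemma old_edge_avoids: "f \<in> edges G - {e} \<Longrightarrow> w \<notin> ends G' f"
  using old[of f] multigraph_ends_subset[OF graph, of f] w by auto

text \<open>Edges of \<open>G'\<close> are sorted by incidence with \<open>w\<close> rather than by
  name, because a name may be reused. Both \<open>e1\<close> and \<open>e2\<close> end at
  \<open>w\<close>, so an edge avoiding \<open>w\<close> is an old edge other than
  \<open>e\<close>.\<close>

lemma edge_not_at_w:
  assumes "f \<in> edges G'" "w \<notin> ends G' f"
  shows "f \<in> edges G" "ends G f = ends G' f" "\<alpha>' f = \<alpha> f"
proof -
  have "f \<in> edges G - {e}" using assms edges' ends' by auto
  then show "f \<in> edges G" "ends G f = ends G' f" "\<alpha>' f = \<alpha> f" using old by auto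
qed

lemma edge_at_w:
  assumes "f \<in> edges G'" "w \<in> ends G' f"
  shows "ends G' f = {u, w} \<or> ends G' f = {w, v}" "\<alpha>' f = \<alpha> e"
proof -
  have "f = e1 \<or> f = e2" using assms edges' old_edge_avoids by auto
  then show "ends G' f = {u, w} \<or> ends G' f = {w, v}" "\<alpha>' f = \<alpha> e"
    using ends' labels' by auto
qed

text \<open>Induction on length rather than structure, because a passage through \<open>w\<close>
  consumes two edges at once. The clause \<open>T \<subseteq> S\<close> guarantees that a vertex
  prepended to the contracted tail is still unvisited there.\<close>

lemma contract_path:
  assumes "path_visiting G' b a S es" "a \<noteq> w" "b \<noteq> w"
  shows "\<exists>T fs. path_visiting G b a T fs \<and> T \<subseteq> S \<and> path_ideal R \<alpha> fs \<subseteq> path_ideal R \<alpha>' es"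
  using assms
proof (induction es arbitrary: a S rule: length_induct)
  case (1 es)
  note IH = 1(1)[rule_format] and path = 1(2) and aw = 1(3) and bw = 1(4)
  from path show ?case
  proof cases
    case Nil
    have "path_visiting G b a {a} []"
      using Nil aw verts' by (auto intro: path_visiting.Nil)
    moreover have "path_ideal R \<alpha> [] \<subseteq> path_ideal R \<alpha>' es" using Nil by (simp add: path_ideal_def)
    moreover have "{a} \<subseteq> S" using Nil by simp
    ultimately show ?thesis by blast
  next
    case (Cons c S1 es1 f)
    show ?thesis
    proof (cases "c = w")
      case False
      then obtain T fs where T: "path_visiting G b c T fs" "T \<subseteq> S1"
        "path_ideal R \<alpha> fs \<subseteq> path_ideal R \<alpha>' es1"
        using IH[OF _ Cons(3) _ bw] Cons(2) by auto
      have f: "f \<in> edges G" "ends G f = {a, c}" "\<alpha>' f = \<alpha> f"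
        using edge_not_at_w[of f] Cons False aw by auto
      have "path_visiting G b a (insert a T) (f # fs)"
        using T f Cons aw verts' by (intro path_visiting.Cons) auto
      moreover have "path_ideal R \<alpha> (f # fs) \<subseteq> path_ideal R \<alpha>' es"
        using T f Cons set_add_mono unfolding path_ideal_def by simp
      ultimately show ?thesis using T Cons by blast
    next
      case True
      from Cons(3) show ?thesis
      proof cases
        case Nil
        \<comment> \<open>The path would stop at \<open>w\<close>, but
          \<open>b \<noteq> w\<close>.\<close>
        then show ?thesis using True bw by simp
      next
        case C2: (Cons d S2 es2 g)
        \<comment> \<open>The set visited from \<open>w\<close> on is \<open>insert w S2\<close>: it
          omits \<open>a\<close>, and \<open>S2\<close> contains \<open>d\<close> but not
          \<open>w\<close>.\<close>
        have ad: "a \<noteq> d" "a \<notin> S2" "d \<noteq> w"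
          using C2 Cons path_visiting_start[OF C2(3)] True by auto
        then obtain T fs where T: "path_visiting G b d T fs" "T \<subseteq> S2"
          "path_ideal R \<alpha> fs \<subseteq> path_ideal R \<alpha>' es2"
          using IH[OF _ C2(3) _ bw] Cons(2) C2(2) by auto
        \<comment> \<open>The edges \<open>f\<close> and \<open>g\<close> join \<open>w\<close> to
          \<open>a\<close> and to \<open>d\<close>. The only neighbours of \<open>w\<close> are
          \<open>u\<close> and \<open>v\<close>, so \<open>a \<noteq> d\<close> forces these to be
          \<open>a\<close> and \<open>d\<close> in some order; in particular \<open>e\<close> is
          then no loop.\<close>
        have "ends G e = {a, d}"
          using edge_at_w(1)[of f] edge_at_w(1)[of g] C2 Cons True ad aw e
          by (fastforce simp: doubleton_eq_iff)
        then have "path_visiting G b a (insert a T) (e # fs)"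
          using T e ad Cons aw verts' by (intro path_visiting.Cons) auto
        moreover have "path_ideal R \<alpha> (e # fs) \<subseteq> path_ideal R \<alpha>' es"
        proof -
          have lab: "\<alpha>' f = \<alpha> e" "\<alpha>' g = \<alpha> e"
            using edge_at_w(2)[of f] edge_at_w(2)[of g] C2 Cons True by auto
          \<comment> \<open>Adding \<open>\<zero>\<close> fixes elements of the carrier, so this
            places the tail ideal inside its sum with \<open>\<alpha> e\<close>.\<close>
          have "path_ideal R \<alpha>' es2 \<subseteq> carrier R"
          proof (rule path_ideal_carrier)
            fix h assume "h \<in> set es2"
            then have "h \<in> edges G'" using path_visiting_edges[OF C2(3)] by blast
            then have "ideal (\<alpha>' h) R" using edge_labeling' unfolding edge_labeling_def by blast
            then show "\<alpha>' h \<subseteq> carrier R" by (simp add: ideal.Icarr subsetI)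
          qed
          moreover have "\<zero> \<in> \<alpha> e"
            using ideal_label[OF e(1)] by (simp add: additive_subgroup.zero_closed ideal.axioms(1))
          ultimately have "path_ideal R \<alpha>' es2 \<subseteq> \<alpha> e <+>\<^bsub>R\<^esub> path_ideal R \<alpha>' es2"
            using subset_set_add_right by blast
          \<comment> \<open>The label of \<open>e\<close> occurs once on the contracted path and
            twice on the original one; the second copy is absorbed by enlarging the tail.\<close>
          then have "\<alpha> e <+>\<^bsub>R\<^esub> path_ideal R \<alpha> fs \<subseteq> \<alpha> e <+>\<^bsub>R\<^esub> (\<alpha> e <+>\<^bsub>R\<^esub> path_ideal R \<alpha>' es2)"
            using T(3) by (intro set_add_mono) auto
          then show ?thesis using Cons C2 lab unfolding path_ideal_def by simp
        qed
        moreover have "insert a T \<subseteq> S" using T C2 Cons by blast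
        ultimately show ?thesis by blast
      qed
    qed
  qed
qed

lemma spline_restrict:
  assumes "spline R G' \<alpha>' \<rho>"
  shows "spline R G \<alpha> \<rho>"
proof -
  have car: "\<rho> a \<in> carrier R" if "a \<in> verts G'" for a
    using assms that unfolding spline_def by auto
  have diff: "\<rho> a \<ominus> \<rho> b \<in> \<alpha>' f" if "f \<in> edges G'" "ends G' f = {a, b}" for a b f
    using assms that unfolding spline_def by blast
  have c: "\<rho> u \<in> carrier R" "\<rho> v \<in> carrier R" "\<rho> w \<in> carrier R"
    using car uv verts' by auto
  interpret I: ideal "\<alpha> e" R using ideal_label[OF e(1)] .
  have "\<rho> u \<ominus> \<rho> w \<in> \<alpha> e" "\<rho> w \<ominus> \<rho> v \<in> \<alpha> e"
    using diff[of e1 u w] diff[of e2 w v] edges' ends' labels' by auto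
  then have "(\<rho> u \<ominus> \<rho> w) \<oplus> (\<rho> w \<ominus> \<rho> v) \<in> \<alpha> e" by (rule I.a_closed)
  moreover have "(\<rho> u \<ominus> \<rho> w) \<oplus> (\<rho> w \<ominus> \<rho> v) = \<rho> u \<ominus> \<rho> v" using c by algebra
  ultimately have uv_diff: "\<rho> u \<ominus> \<rho> v \<in> \<alpha> e" by simp
  \<comment> \<open>The spline condition ranges over both orderings of the endpoints of an edge,
    hence the reversed difference.\<close>
  then have "\<ominus> (\<rho> u \<ominus> \<rho> v) \<in> \<alpha> e" by (rule I.a_inv_closed)
  moreover have "\<ominus> (\<rho> u \<ominus> \<rho> v) = \<rho> v \<ominus> \<rho> u" using c by algebra
  ultimately have vu_diff: "\<rho> v \<ominus> \<rho> u \<in> \<alpha> e" by simp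
  have "\<rho> a \<ominus> \<rho> b \<in> \<alpha> f" if f: "f \<in> edges G" "ends G f = {a, b}" for a b f
  proof (cases "f = e")
    case True
    then have "a = u \<and> b = v \<or> a = v \<and> b = u" using f e by (auto simp: doubleton_eq_iff)
    then show ?thesis using uv_diff vu_diff True by blast
  next
    case False
    then show ?thesis using diff[of f a b] old[of f] f edges' by auto
  qed
  then show ?thesis unfolding spline_def using car verts' by auto
qed

lemma UDP_contract:
  assumes "UDP R G' \<alpha>'"
  shows "UDP R G \<alpha>"
  unfolding UDP_def
proof (intro ballI)
  fix a b x
  assume ab: "a \<in> verts G" "b \<in> verts G"
    and x: "x \<in> carrier R \<inter> (\<Inter>P\<in>paths G a b. path_ideal R \<alpha> P)"
  have "x \<in> path_ideal R \<alpha>' P" if P: "P \<in> paths G' a b" for P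
  proof -
    obtain S where "path_visiting G' b a S P" using P paths_iff_path_visiting by metis
    then obtain T fs where "path_visiting G b a T fs" "path_ideal R \<alpha> fs \<subseteq> path_ideal R \<alpha>' P"
      \<comment> \<open>Contraction applies since \<open>a\<close> and \<open>b\<close> are old
        vertices, hence different from \<open>w\<close>.\<close>
      using contract_path ab w by metis
    then show ?thesis using x paths_iff_path_visiting by fastforce
  qed
  then have "x \<in> carrier R \<inter> (\<Inter>P\<in>paths G' a b. path_ideal R \<alpha>' P)" using x by blast
  moreover have "a \<in> verts G'" "b \<in> verts G'" using ab verts' by auto
  ultimately obtain \<rho> where "spline R G' \<alpha>' \<rho>" "\<rho> a \<ominus> \<rho> b = x"
    using assms[unfolded UDP_def, rule_format, of a b x] by auto
  then show "\<exists>\<rho>. spline R G \<alpha> \<rho> \<and> \<rho> a \<ominus> \<rho> b = x" using spline_restrict by blast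
qed

end

lemma subdivide_edgeE:
  assumes "subdivide_edge G \<alpha> G' \<alpha>'" "cring R" "multigraph G" "edge_labeling R G \<alpha>"
  obtains e e1 e2 u v w where "edge_subdivision R G G' \<alpha> \<alpha>' e e1 e2 u v w"
proof -
  from assms(1) obtain e u v w e1 e2 where "e \<in> edges G" "ends G e = {u, v}" "w \<notin> verts G"
    "verts G' = insert w (verts G)" "edges G' = (edges G - {e}) \<union> {e1, e2}"
    "\<forall>f \<in> edges G - {e}. ends G' f = ends G f \<and> \<alpha>' f = \<alpha> f"
    "ends G' e1 = {u, w}" "ends G' e2 = {w, v}" "\<alpha>' e1 = \<alpha> e" "\<alpha>' e2 = \<alpha> e"
    unfolding subdivide_edge_def by (elim exE conjE)
  then have "edge_subdivision R G G' \<alpha> \<alpha>' e e1 e2 u v w"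
    using assms(2-4) by (intro edge_subdivision.intro edge_subdivision_axioms.intro) blast+
  then show thesis by (rule that)
qed

theorem theorem3p7:
  fixes R :: "('r, 'm) ring_scheme" and G :: "('v, 'e) mgraph" and \<alpha> :: "'e \<Rightarrow> 'r set"
  assumes "cring R"
    and "multigraph G"
    and "edge_labeling R G \<alpha>"
    and "\<not> UDP R G \<alpha>"
  shows "\<not> (\<exists>G' \<alpha>'. subdivision G \<alpha> G' \<alpha>' \<and> UDP R G' \<alpha>')"
proof -
  \<comment> \<open>Well-formedness of graph and labeling is carried through the induction, since
    each further subdivision step requires it of the graph being subdivided.\<close>
  have "multigraph G' \<and> edge_labeling R G' \<alpha>' \<and> \<not> UDP R G' \<alpha>'" if "subdivision G \<alpha> G' \<alpha>'" for G' \<alpha>'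
    using that
  proof induction
    case refl
    then show ?case using assms by blast
  next
    case (step H \<beta> H' \<beta>')
    then obtain e e1 e2 u v w where "edge_subdivision R H H' \<beta> \<beta>' e e1 e2 u v w"
      using subdivide_edgeE assms(1) by metis
    then interpret edge_subdivision R H H' \<beta> \<beta>' e e1 e2 u v w .
    show ?case using multigraph' edge_labeling' UDP_contract step by blast
  qed
  then show ?thesis by blast
qed

end
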